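(* Let $(T,S,N)$ be a relative Rota-Baxter-Nijenhuis structure on a LieYRep pair $((\mathfrak g,[\cdot,\cdot],[\![\cdot,\cdot,\cdot]\!]),(V;\rho,\mu))$. Then $S$ is a Nijenhuis operator on the sub-adjacent Lie-Yamaguti algebra $(V,[\cdot,\cdot]^T,[\![\cdot,\cdot,\cdot]\!]^T)$. Thus $([\cdot,\cdot]^T_S,[\![\cdot,\cdot,\cdot]\!]^T_S)$ and $([\cdot,\cdot]^T_{\hat\rho},[\![\cdot,\cdot,\cdot]\!]^T_{\hat\mu})$ are Lie-Yamaguti algebra structures on $V$.
   Context: All vector spaces are finite-dimensional over a field $\mathbb K$ of characteristic $0$. A Lie-Yamaguti algebra is a vector space $\mathfrak g$ with a bilinear map $[\cdot,\cdot]:\wedge^2\mathfrak g\to\mathfrak g$ and a trilinear map $[\![\cdot,\cdot,\cdot]\!]:\wedge^2\mathfrak g\otimes\mathfrak g\to\mathfrak g$ such that for all $x,y,z,w,t\in\mathfrak g$: (1) $[[x,y],z]+[[y,z],x]+[[z,x],y]+[\![x,y,z]\!]+[\![y,z,x]\!]+[\![z,x,y]\!]=0$; (2) $[\![[x,y],z,w]\!]+[\![[y,z],x,w]\!]+[\![[z,x],y,w]\!]=0$; (3) $[\![x,y,[z,w]]\!]=[[\![x,y,z]\!],w]+[z,[\![x,y,w]\!]]$; (4) $[\![x,y,[\![z,w,t]\!]]\!]=[\![[\![x,y,z]\!],w,t]\!]+[\![z,[\![x,y,w]\!],t]\!]+[\![z,w,[\![x,y,t]\!]]\!]$. A representation $(V;\rho,\mu)$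 of $\mathfrak g$ is a vector space $V$ with linear maps $\rho:\mathfrak g\to\mathfrak{gl}(V)$, $\mu:\otimes^2\mathfrak g\to\mathfrak{gl}(V)$ such that, with $D(x,y)=D_{\rho,\mu}(x,y):=\mu(y,x)-\mu(x,y)+[\rho(x),\rho(y)]-\rho([x,y])$, for all $x,y,z,w\in\mathfrak g$: $\mu([x,y],z)-\mu(x,z)\rho(y)+\mu(y,z)\rho(x)=0$; $\mu(x,[y,z])-\rho(y)\mu(x,z)+\rho(z)\mu(x,y)=0$; $\rho([\![x,y,z]\!])=[D(x,y),\rho(z)]$; $\mu(z,w)\mu(x,y)-\mu(y,w)\mu(x,z)-\mu(x,[\![y,z,w]\!])+D(y,z)\mu(x,w)=0$; $\mu([\![x,y,z]\!],w)+\mu(z,[\![x,y,w]\!])=[D(x,y),\mu(z,w)]$. A Lie-Yamaguti algebra together with a representation is called a LieYRep pair. Nijenhuis operator on a Lie-Yamaguti algebra: a linear map $N:\mathfrak g\to\mathfrak g$ such that, with $[x,y]_N=[Nx,y]+[x,Ny]-N[x,y]$ and $[\![x,y,z]\!]_N=[\![Nx,Ny,z]\!]+[\![x,Ny,Nz]\!]+[\![Nx,y,Nz]\!]-N([\![Nx,y,z]\!]+[\![x,Ny,z]\!]+[\![x,y,Nz]\!])+N^2[\![x,y,z]\!]$, one has $[Nx,Ny]=N[x,y]_N$ and $[\![Nx,Ny,Nz]\!]=N[\![x,y,z]\!]_N$. For $N\in\mathfrak{gl}(\mathfrak g)$, $S\in\mathfrak{gl}(V)$ put $\hat\rho(x)=\rho(Nx)+\rho(x)\circ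 S-S\circ\rho(x)$, $\hat\mu(x,y)=\mu(Nx,y)\circ S+\mu(x,Ny)\circ S+\mu(Nx,Ny)-S\circ(\mu(Nx,y)+\mu(x,Ny)+\mu(x,y)\circ S)+S^2\circ\mu(x,y)$, $\hat D(x,y)=D(Nx,y)\circ S+D(x,Ny)\circ S+D(Nx,Ny)-S\circ(D(Nx,y)+D(x,Ny)+D(x,y)\circ S)+S^2\circ D(x,y)$. Nijenhuis structure on a LieYRep pair: $(N,S)$ such that $N$ is a Nijenhuis operator on $\mathfrak g$ and $\rho(Nx)\circ S=S\circ\hat\rho(x)$, $\mu(Nx,Ny)\circ S=S\circ\hat\mu(x,y)$ for all $x,y\in\mathfrak g$. For a linear map $T:V\to\mathfrak g$ put $[u,v]^T=\rho(Tu)v-\rho(Tv)u$ and $[\![u,v,w]\!]^T=D(Tu,Tv)w+\mu(Tv,Tw)u-\mu(Tu,Tw)v$. $T$ is a relative Rota-Baxter operator on $\mathfrak g$ with respect to $(V;\rho,\mu)$ if $[Tu,Tv]=T[u,v]^T$ and $[\![Tu,Tv,Tw]\!]=T[\![u,v,w]\!]^T$ for all $u,v,w\in V$; in that case $(V,[\cdot,\cdot]^T,[\![\cdot,\cdot,\cdot]\!]^T)$ is (a known fact) a Lie-Yamaguti algebra, called the sub-adjacent Lie-Yamaguti algebra. Further, $[u,v]^T_S=[Su,v]^T+[u,Sv]^T-S[u,v]^T$; $[\![u,v,w]\!]^T_S=[\![Su,Sv,w]\!]^T+[\![Su,v,Sw]\!]^T+[\![u,Sv,Sw]\!]^T-S([\![Su,v,w]\!]^T+[\![u,Sv,w]\!]^T+[\![u,v,Sw]\!]^T)+S^2[\![u,v,w]\!]^T$;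 $[u,v]^T_{\hat\rho}=\hat\rho(Tu)v-\hat\rho(Tv)u$; $[\![u,v,w]\!]^T_{\hat\mu}=\hat D(Tu,Tv)w+\hat\mu(Tv,Tw)u-\hat\mu(Tu,Tw)v$. Relative Rota-Baxter-Nijenhuis structure: a triple $(T,S,N)$ where $(N,S)$ is a Nijenhuis structure on the pair, $T$ is a relative Rota-Baxter operator, and for all $u,v,w\in V$: $N\circ T=T\circ S$, $[u,v]^T_S=[u,v]^{N\circ T}$, $[\![u,v,w]\!]^T_S=[\![u,v,w]\!]^{N\circ T}$. *)

theory Defs
  imports Complex_Main
begin

text \<open>Vector spaces are given by an additive group type together with an explicit scalar
  multiplication (locale \<open>vector_space\<close>); here the scalars form a field of characteristic 0.
  Elements of gl(V) are functions \<open>'v \<Rightarrow> 'v\<close>, required to be linear, and linearity of a map into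
  gl(V) is stated pointwise.\<close>

section \<open>Lie-Yamaguti algebras\<close>

text \<open>A bilinear map defined on the exterior square is a bilinear map vanishing on the diagonal.
  Linearity in the second of the two alternating arguments follows from the other axioms.\<close>

locale lie_yamaguti_algebra = vector_space scale
  for scale :: "'k::field_char_0 \<Rightarrow> 'g::ab_group_add \<Rightarrow> 'g" +
  fixes br :: "'g \<Rightarrow> 'g \<Rightarrow> 'g"
    and tr :: "'g \<Rightarrow> 'g \<Rightarrow> 'g \<Rightarrow> 'g"
  assumes br_linear_left: "Vector_Spaces.linear scale scale (\<lambda>x. br x y)"
    and br_linear_right: "Vector_Spaces.linear scale scale (\<lambda>y. br x y)"
    and br_alternating: "br x x = 0"
    and tr_linear_1: "Vector_Spaces.linear scale scale (\<lambda>x. tr x y z)"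
    and tr_linear_2: "Vector_Spaces.linear scale scale (\<lambda>y. tr x y z)"
    and tr_linear_3: "Vector_Spaces.linear scale scale (\<lambda>z. tr x y z)"
    and tr_alternating: "tr x x z = 0"
    and LY1: "br (br x y) z + br (br y z) x + br (br z x) y
      + tr x y z + tr y z x + tr z x y = 0"
    and LY2: "tr (br x y) z w + tr (br y z) x w + tr (br z x) y w = 0"
    and LY3: "tr x y (br z w) = br (tr x y z) w + br z (tr x y w)"
    and LY4: "tr x y (tr z w t) = tr (tr x y z) w t + tr z (tr x y w) t + tr z w (tr x y t)"

text \<open>For a bracket \<open>br\<close> and a linear map \<open>N\<close>, the operations \<open>[x,y]\<^sub>N\<close> and \<open>[[x,y,z]]\<^sub>N\<close>.\<close>

definition deformed_br :: "('g::ab_group_add \<Rightarrow> 'g \<Rightarrow> 'g) \<Rightarrow> ('g \<Rightarrow> 'g) \<Rightarrow> 'g \<Rightarrow> 'g \<Rightarrow> 'g" where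
  "deformed_br br N x y = br (N x) y + br x (N y) - N (br x y)"

definition deformed_tr ::
  "('g::ab_group_add \<Rightarrow> 'g \<Rightarrow> 'g \<Rightarrow> 'g) \<Rightarrow> ('g \<Rightarrow> 'g) \<Rightarrow> 'g \<Rightarrow> 'g \<Rightarrow> 'g \<Rightarrow> 'g" where
  "deformed_tr tr N x y z =
    tr (N x) (N y) z + tr x (N y) (N z) + tr (N x) y (N z)
    - N (tr (N x) y z + tr x (N y) z + tr x y (N z))
    + N (N (tr x y z))"

locale nijenhuis_operator = lie_yamaguti_algebra scale br tr
  for scale :: "'k::field_char_0 \<Rightarrow> 'g::ab_group_add \<Rightarrow> 'g" and br tr +
  fixes N :: "'g \<Rightarrow> 'g"
  assumes N_linear: "Vector_Spaces.linear scale scale N"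
    and nijenhuis_br: "br (N x) (N y) = N (deformed_br br N x y)"
    and nijenhuis_tr: "tr (N x) (N y) (N z) = N (deformed_tr tr N x y z)"

section \<open>Representations\<close>

definition rep_D ::
  "('g \<Rightarrow> 'g \<Rightarrow> 'g) \<Rightarrow> ('g \<Rightarrow> 'v::ab_group_add \<Rightarrow> 'v) \<Rightarrow> ('g \<Rightarrow> 'g \<Rightarrow> 'v \<Rightarrow> 'v) \<Rightarrow> 'g \<Rightarrow> 'g \<Rightarrow> 'v \<Rightarrow> 'v"
where
  "rep_D br \<rho> \<mu> x y v =
    \<mu> y x v - \<mu> x y v + (\<rho> x (\<rho> y v) - \<rho> y (\<rho> x v)) - \<rho> (br x y) v"

text \<open>A Lie-Yamaguti algebra with a representation (a LieYRep pair).\<close>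

locale lieyrep_pair =
  alg: lie_yamaguti_algebra scaleG br tr + rep: vector_space scaleV
  for scaleG :: "'k::field_char_0 \<Rightarrow> 'g::ab_group_add \<Rightarrow> 'g" and br tr
    and scaleV :: "'k \<Rightarrow> 'v::ab_group_add \<Rightarrow> 'v" +
  fixes \<rho> :: "'g \<Rightarrow> 'v \<Rightarrow> 'v"
    and \<mu> :: "'g \<Rightarrow> 'g \<Rightarrow> 'v \<Rightarrow> 'v"
  assumes rho_endo: "Vector_Spaces.linear scaleV scaleV (\<rho> x)"
    and rho_linear: "Vector_Spaces.linear scaleG scaleV (\<lambda>x. \<rho> x v)"
    and mu_endo: "Vector_Spaces.linear scaleV scaleV (\<mu> x y)"
    and mu_linear_left: "Vector_Spaces.linear scaleG scaleV (\<lambda>x. \<mu> x y v)"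
    and mu_linear_right: "Vector_Spaces.linear scaleG scaleV (\<lambda>y. \<mu> x y v)"
    and rep1: "\<mu> (br x y) z v - \<mu> x z (\<rho> y v) + \<mu> y z (\<rho> x v) = 0"
    and rep2: "\<mu> x (br y z) v - \<rho> y (\<mu> x z v) + \<rho> z (\<mu> x y v) = 0"
    and rep3: "\<rho> (tr x y z) v =
      rep_D br \<rho> \<mu> x y (\<rho> z v) - \<rho> z (rep_D br \<rho> \<mu> x y v)"
    and rep4: "\<mu> z w (\<mu> x y v) - \<mu> y w (\<mu> x z v) - \<mu> x (tr y z w) v
      + rep_D br \<rho> \<mu> y z (\<mu> x w v) = 0"
    and rep5: "\<mu> (tr x y z) w v + \<mu> z (tr x y w) v =
      rep_D br \<rho> \<mu> x y (\<mu> z w v) - \<mu> z w (rep_D br \<rho> \<mu> x y v)"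

definition hat1 ::
  "('g \<Rightarrow> 'v::ab_group_add \<Rightarrow> 'v) \<Rightarrow> ('g \<Rightarrow> 'g) \<Rightarrow> ('v \<Rightarrow> 'v) \<Rightarrow> 'g \<Rightarrow> 'v \<Rightarrow> 'v"
where
  "hat1 \<rho> N S x v = \<rho> (N x) v + \<rho> x (S v) - S (\<rho> x v)"

text \<open>The hatted maps for \<open>\<mu>\<close> and \<open>D\<close> are given by the same formula, applied to
  \<open>F = \<mu>\<close> and \<open>F = D\<close>.\<close>

definition hat2 ::
  "('g \<Rightarrow> 'g \<Rightarrow> 'v::ab_group_add \<Rightarrow> 'v) \<Rightarrow> ('g \<Rightarrow> 'g) \<Rightarrow> ('v \<Rightarrow> 'v) \<Rightarrow> 'g \<Rightarrow> 'g \<Rightarrow> 'v \<Rightarrow> 'v"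
where
  "hat2 F N S x y v =
    F (N x) y (S v) + F x (N y) (S v) + F (N x) (N y) v
    - S (F (N x) y v + F x (N y) v + F x y (S v))
    + S (S (F x y v))"

locale nijenhuis_structure =
  lieyrep_pair scaleG br tr scaleV \<rho> \<mu> + nij: nijenhuis_operator scaleG br tr N
  for scaleG :: "'k::field_char_0 \<Rightarrow> 'g::ab_group_add \<Rightarrow> 'g" and br tr
    and scaleV :: "'k \<Rightarrow> 'v::ab_group_add \<Rightarrow> 'v" and \<rho> \<mu> N +
  fixes S :: "'v \<Rightarrow> 'v"
  assumes S_linear: "Vector_Spaces.linear scaleV scaleV S"
    and nijenhuis_rho: "\<rho> (N x) (S v) = S (hat1 \<rho> N S x v)"
    and nijenhuis_mu: "\<mu> (N x) (N y) (S v) = S (hat2 \<mu> N S x y v)"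

section \<open>Relative Rota-Baxter operators\<close>

text \<open>For \<open>D = rep_D br \<rho> \<mu>\<close> these are \<open>[u,v]\<^sup>T\<close> and \<open>[[u,v,w]]\<^sup>T\<close>; for the hatted
  \<open>\<rho>\<close>, \<open>D\<close>, \<open>\<mu>\<close> they are the brackets indexed by the hatted \<open>\<rho>\<close> and \<open>\<mu>\<close>.\<close>

definition induced_br ::
  "('g \<Rightarrow> 'v::ab_group_add \<Rightarrow> 'v) \<Rightarrow> ('v \<Rightarrow> 'g) \<Rightarrow> 'v \<Rightarrow> 'v \<Rightarrow> 'v"
where
  "induced_br \<rho> T u v = \<rho> (T u) v - \<rho> (T v) u"

definition induced_tr ::
  "('g \<Rightarrow> 'g \<Rightarrow> 'v::ab_group_add \<Rightarrow> 'v) \<Rightarrow> ('g \<Rightarrow> 'g \<Rightarrow> 'v \<Rightarrow> 'v) \<Rightarrow> ('v \<Rightarrow> 'g)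
    \<Rightarrow> 'v \<Rightarrow> 'v \<Rightarrow> 'v \<Rightarrow> 'v"
where
  "induced_tr D \<mu> T u v w = D (T u) (T v) w + \<mu> (T v) (T w) u - \<mu> (T u) (T w) v"

locale relative_rota_baxter_operator = lieyrep_pair scaleG br tr scaleV \<rho> \<mu>
  for scaleG :: "'k::field_char_0 \<Rightarrow> 'g::ab_group_add \<Rightarrow> 'g" and br tr
    and scaleV :: "'k \<Rightarrow> 'v::ab_group_add \<Rightarrow> 'v" and \<rho> \<mu> +
  fixes T :: "'v \<Rightarrow> 'g"
  assumes T_linear: "Vector_Spaces.linear scaleV scaleG T"
    and rota_baxter_br: "br (T u) (T v) = T (induced_br \<rho> T u v)"
    and rota_baxter_tr: "tr (T u) (T v) (T w) = T (induced_tr (rep_D br \<rho> \<mu>) \<mu> T u v w)"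

locale relative_rota_baxter_nijenhuis_structure =
  nijenhuis_structure scaleG br tr scaleV \<rho> \<mu> N S +
  rota_baxter: relative_rota_baxter_operator scaleG br tr scaleV \<rho> \<mu> T
  for scaleG :: "'k::field_char_0 \<Rightarrow> 'g::ab_group_add \<Rightarrow> 'g" and br tr
    and scaleV :: "'k \<Rightarrow> 'v::ab_group_add \<Rightarrow> 'v" and \<rho> \<mu> T S N +
  assumes NT_eq_TS: "N \<circ> T = T \<circ> S"
    and compat_br: "deformed_br (induced_br \<rho> T) S u v = induced_br \<rho> (N \<circ> T) u v"
    and compat_tr: "deformed_tr (induced_tr (rep_D br \<rho> \<mu>) \<mu> T) S u v w =
      induced_tr (rep_D br \<rho> \<mu>) \<mu> (N \<circ> T) u v w"

end

theory Submission
  imports Defs "HOL-Analysis.Product_Vector"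
begin

text \<open>
  Everything takes place in the semidirect product \<open>P\<close>, a Lie-Yamaguti algebra on
  \<open>\<gg> \<times> V\<close> built from the representation (\<open>lie_yamaguti_algebra_semidirect\<close>). The defining identities
  of a relative Rota-Baxter operator say that the graph embedding \<open>u \<mapsto> (T u, u)\<close> takes the
  operations \<open>[\<cdot>,\<cdot>]\<^sup>T\<close>, \<open>[[\<cdot>,\<cdot>,\<cdot>]]\<^sup>T\<close> to those of \<open>P\<close>. The relations of a
  Nijenhuis structure say that \<open>N \<times> S\<close> is a Nijenhuis operator on \<open>P\<close>
  (\<open>nijenhuis_operator_semidirect\<close>); the one relation to be derived is that for \<open>D\<close>
  (\<open>nijenhuis_D\<close>). Finally \<open>N \<circ> T = T \<circ> S\<close> says that the graph of \<open>T\<close> is stable under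
  \<open>N \<times> S\<close>, which acts on it as \<open>S\<close>. Since the embedding is injective, the sub-adjacent
  Lie-Yamaguti structure on \<open>V\<close> and the Nijenhuis property of \<open>S\<close> are both inherited from
  \<open>P\<close>.

  It remains to see that deforming a Lie-Yamaguti algebra by a Nijenhuis operator \<open>N\<close> gives a
  Lie-Yamaguti algebra (\<open>lie_yamaguti_algebra_deformed\<close>). For a scalar \<open>s\<close> let \<open>A = s + N\<close>. There
  are operations, polynomial in \<open>s\<close> and equal to the deformed ones at \<open>s = 0\<close>, that \<open>A\<close> carries
  to the original operations. Hence \<open>A\<close> kills the defect of each Lie-Yamaguti identity for them.
  That defect is a polynomial in \<open>s\<close>, and \<open>s + N\<close> is injective on polynomials in \<open>s\<close>
  even if it is not injective for individual \<open>s\<close>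
  (\<open>polynomial_curve_annihilated_by_pencil\<close>), so the defect vanishes, in particular at \<open>s = 0\<close>.

  The hatted operations need no separate treatment: expanding the definitions with
  \<open>N \<circ> T = T \<circ> S\<close> shows that they are the deformed sub-adjacent operations.
\<close>

section \<open>Linear maps\<close>

text \<open>A characterization of linearity that presupposes no vector space structure.\<close>

lemma vector_space_linear_iff:
  "Vector_Spaces.linear s1 s2 f \<longleftrightarrow> vector_space s1 \<and> vector_space s2
    \<and> (\<forall>x y. f (x + y) = f x + f y) \<and> (\<forall>c x. f (s1 c x) = s2 c (f x))"
  unfolding Vector_Spaces.linear_def module_hom_iff vector_space_def module_def by auto

section \<open>Curves that are polynomial in a scalar parameter\<close>

text \<open>The inductive form makes closure under multilinear operations immediate; coefficients are
  extracted only once, in \<open>polynomial_curve_coefficients\<close>.\<close>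

inductive polynomial_curve :: "('k::field \<Rightarrow> 'v::ab_group_add \<Rightarrow> 'v) \<Rightarrow> ('k \<Rightarrow> 'v) \<Rightarrow> bool"
  for scale where
  const: "polynomial_curve scale (\<lambda>_. v)"
| add: "polynomial_curve scale f \<Longrightarrow> polynomial_curve scale g
    \<Longrightarrow> polynomial_curve scale (\<lambda>s. f s + g s)"
| shift: "polynomial_curve scale f \<Longrightarrow> polynomial_curve scale (\<lambda>s. scale s (f s))"

context vector_space
begin

lemma polynomial_curve_linear_image:
  assumes "Vector_Spaces.linear scale scale h" "polynomial_curve scale f"
  shows "polynomial_curve scale (\<lambda>s. h (f s))"
  using assms(2)
  by induction (auto intro: polynomial_curve.intros
      simp: module_hom.add[OF Vector_Spaces.linear.axioms(3)[OF assms(1)]]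
        module_hom.scale[OF Vector_Spaces.linear.axioms(3)[OF assms(1)]])

lemma polynomial_curve_bilinear:
  assumes left: "\<And>y. Vector_Spaces.linear scale scale (\<lambda>x. B x y)"
    and right: "\<And>x. Vector_Spaces.linear scale scale (\<lambda>y. B x y)"
    and "polynomial_curve scale f" and g: "polynomial_curve scale g"
  shows "polynomial_curve scale (\<lambda>s. B (f s) (g s))"
  using assms(3)
  by induction (auto intro: polynomial_curve.intros polynomial_curve_linear_image[OF right g]
      simp: module_hom.add[OF Vector_Spaces.linear.axioms(3)[OF left]]
        module_hom.scale[OF Vector_Spaces.linear.axioms(3)[OF left]])

lemma polynomial_curve_trilinear:
  assumes first: "\<And>y z. Vector_Spaces.linear scale scale (\<lambda>x. B x y z)"
    and "\<And>x z. Vector_Spaces.linear scale scale (\<lambda>y. B x y z)"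
    and "\<And>x y. Vector_Spaces.linear scale scale (\<lambda>z. B x y z)"
    and "polynomial_curve scale f"
    and g: "polynomial_curve scale g" and h: "polynomial_curve scale h"
  shows "polynomial_curve scale (\<lambda>s. B (f s) (g s) (h s))"
  using assms(4)
  by induction (auto intro: polynomial_curve.intros
      polynomial_curve_bilinear[OF assms(2) assms(3) g h]
      simp: module_hom.add[OF Vector_Spaces.linear.axioms(3)[OF first]]
        module_hom.scale[OF Vector_Spaces.linear.axioms(3)[OF first]])

text \<open>The bound on the degree is left open upwards, so that two curves can be brought to a common
  number of coefficients.\<close>

lemma polynomial_curve_coefficients:
  assumes "polynomial_curve scale f"
  shows "\<exists>v m. \<forall>n s. n \<ge> m \<longrightarrow> f s = (\<Sum>i<n. scale (s ^ i) (v i))"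
  using assms
proof induction
  case (const w)
  have "w = (\<Sum>i<n. scale (s ^ i) (if i = 0 then w else 0))" if n: "n \<ge> 1" for n s
  proof -
    obtain k where "n = Suc k" using n by (cases n) auto
    then show ?thesis by (simp only: sum.lessThan_Suc_shift) simp
  qed
  then show ?case
    by (intro exI[of _ "\<lambda>i. if i = 0 then w else 0"] exI[of _ 1]) blast
next
  case (add f g)
  then obtain v m v' m' where
    "\<And>n s. n \<ge> m \<Longrightarrow> f s = (\<Sum>i<n. scale (s ^ i) (v i))"
    "\<And>n s. n \<ge> m' \<Longrightarrow> g s = (\<Sum>i<n. scale (s ^ i) (v' i))" by meson
  then have "\<forall>n s. n \<ge> max m m' \<longrightarrow> f s + g s = (\<Sum>i<n. scale (s ^ i) (v i + v' i))"
    unfolding scale_right_distrib sum.distrib by (metis max.bounded_iff)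
  then show ?case
    by (intro exI[of _ "\<lambda>i. v i + v' i"] exI[of _ "max m m'"])
next
  case (shift f)
  then obtain v m where v: "\<And>n s. n \<ge> m \<Longrightarrow> f s = (\<Sum>i<n. scale (s ^ i) (v i))" by meson
  have "scale s (f s) = (\<Sum>i<n. scale (s ^ i) (if i = 0 then 0 else v (i - 1)))"
    if n: "n \<ge> Suc m" for n s
  proof -
    obtain k where k: "n = Suc k" "k \<ge> m" using n by (cases n) auto
    then show ?thesis by (simp only: sum.lessThan_Suc_shift v[OF k(2)]) (simp add: scale_sum_right)
  qed
  then show ?case
    by (intro exI[of _ "\<lambda>i. if i = 0 then 0 else v (i - 1)"] exI[of _ "Suc m"]) blast
qed

end

text \<open>A polynomial function with vector coefficients determines them. Comparing the values at
  \<open>s\<close> and \<open>2 s\<close> removes the leading term and multiplies the other coefficients by nonzero scalars;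
  this is where characteristic 0 enters.\<close>

lemma polynomial_coefficients_zero:
  fixes scale :: "'k::field_char_0 \<Rightarrow> 'v::ab_group_add \<Rightarrow> 'v"
  assumes "vector_space scale"
    and "\<And>s. (\<Sum>i<n. scale (s ^ i) (v i)) = 0" and "i < n"
  shows "v i = 0"
  using assms(2,3)
proof (induction n arbitrary: v i)
  interpret vector_space scale by fact
  case (Suc n)
  have low: "v i = 0" if i: "i < n" for i
  proof -
    \<comment> \<open>Subtracting \<open>2\<^sup>n f(s)\<close> from \<open>f(2 s)\<close> cancels the leading term.\<close>
    have "(\<Sum>i<n. scale (s ^ i) (scale (2 ^ i - 2 ^ n) (v i))) = 0" for s
    proof -
      have "0 = (\<Sum>i<Suc n. scale ((2 * s) ^ i) (v i)) - scale (2 ^ n) (\<Sum>i<Suc n. scale (s ^ i) (v i))"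
        by (simp only: Suc.prems(1)) simp
      also have "\<dots> = (\<Sum>i<n. scale (s ^ i) (scale (2 ^ i - 2 ^ n) (v i)))"
        unfolding sum.lessThan_Suc scale_right_distrib scale_sum_right
        by (simp add: sum_subtractf[symmetric] scale_left_diff_distrib scale_right_diff_distrib
            power_mult_distrib mult.commute)
      finally show ?thesis by simp
    qed
    from Suc.IH[OF this i] have "scale (2 ^ i - 2 ^ n) (v i) = 0" .
    moreover have "(2::'k) ^ i \<noteq> 2 ^ n"
    proof
      assume "(2::'k) ^ i = 2 ^ n"
      then have "of_nat (2 ^ i) = (of_nat (2 ^ n) :: 'k)" by simp
      then show False using i by (simp only: of_nat_eq_iff) simp
    qed
    ultimately show ?thesis by simp
  qed
  moreover have "v n = 0" using Suc.prems(1)[of 1] low by simp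
  ultimately show ?case using Suc.prems(2) by (auto simp: less_Suc_eq)
qed simp

text \<open>The coefficients \<open>v\<^sub>i\<close> of \<open>f\<close> satisfy \<open>v\<^sub>i + N (v\<^sub>i\<^sub>+\<^sub>1) = 0\<close>, and the last one vanishes, so all
  of them do, by descending induction.\<close>

lemma polynomial_curve_annihilated_by_pencil:
  fixes scale :: "'k::field_char_0 \<Rightarrow> 'v::ab_group_add \<Rightarrow> 'v"
  assumes N: "Vector_Spaces.linear scale scale N" and "polynomial_curve scale f"
    and zero: "\<And>s. scale s (f s) + N (f s) = 0"
  shows "f s = 0"
proof -
  interpret vector_space scale using N by (rule Vector_Spaces.linear.axioms(1))
  note N_hom = N[THEN Vector_Spaces.linear.axioms(3)]
  obtain m v where v: "\<And>n s. n \<ge> m \<Longrightarrow> f s = (\<Sum>i<n. scale (s ^ i) (v i))"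
    using polynomial_curve_coefficients[OF assms(2)] by meson
  \<comment> \<open>The coefficients of \<open>s f(s) + N (f(s))\<close>.\<close>
  define w where "w i = (if i = 0 then 0 else v (i - 1)) + (if i < m then N (v i) else 0)" for i
  have w: "w i = 0" if "i < Suc m" for i
  proof (rule polynomial_coefficients_zero[OF vector_space_axioms _ that])
    fix s
    have "scale s (f s) = (\<Sum>i<Suc m. scale (s ^ i) (if i = 0 then 0 else v (i - 1)))"
      by (simp only: sum.lessThan_Suc_shift v[OF order_refl]) (simp add: scale_sum_right)
    moreover have "N (f s) = (\<Sum>i<Suc m. scale (s ^ i) (if i < m then N (v i) else 0))"
      by (simp add: v[OF order_refl] module_hom.sum[OF N_hom] module_hom.scale[OF N_hom])
    ultimately show "(\<Sum>i<Suc m. scale (s ^ i) (w i)) = 0"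
      using zero[of s] by (simp only: w_def scale_right_distrib sum.distrib)
  qed
  have "v i = 0" if "i < m" for i
    using that
  proof (induction "m - i" arbitrary: i rule: less_induct)
    case less
    have "N (v (Suc i)) = 0" if "Suc i < m"
      using less.hyps[of "Suc i"] less.prems that by (simp add: module_hom.zero[OF N_hom])
    then show ?case using w[of "Suc i"] less.prems by (simp add: w_def split: if_splits)
  qed
  then show ?thesis using v[of m s] by simp
qed

section \<open>Deformation by a Nijenhuis operator\<close>

context lie_yamaguti_algebra
begin

lemmas br_hom_left = br_linear_left[THEN Vector_Spaces.linear.axioms(3)]
lemmas br_hom_right = br_linear_right[THEN Vector_Spaces.linear.axioms(3)]
lemmas tr_hom_1 = tr_linear_1[THEN Vector_Spaces.linear.axioms(3)]
lemmas tr_hom_2 = tr_linear_2[THEN Vector_Spaces.linear.axioms(3)]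
lemmas tr_hom_3 = tr_linear_3[THEN Vector_Spaces.linear.axioms(3)]

lemmas multilinear_simps =
  br_hom_left[THEN module_hom.add] br_hom_right[THEN module_hom.add]
  br_hom_left[THEN module_hom.scale] br_hom_right[THEN module_hom.scale]
  br_hom_left[THEN module_hom.diff] br_hom_right[THEN module_hom.diff]
  br_hom_left[THEN module_hom.neg] br_hom_right[THEN module_hom.neg]
  br_hom_left[THEN module_hom.zero] br_hom_right[THEN module_hom.zero]
  tr_hom_1[THEN module_hom.add] tr_hom_2[THEN module_hom.add] tr_hom_3[THEN module_hom.add]
  tr_hom_1[THEN module_hom.scale] tr_hom_2[THEN module_hom.scale] tr_hom_3[THEN module_hom.scale]
  tr_hom_1[THEN module_hom.diff] tr_hom_2[THEN module_hom.diff] tr_hom_3[THEN module_hom.diff]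
  tr_hom_1[THEN module_hom.neg] tr_hom_2[THEN module_hom.neg] tr_hom_3[THEN module_hom.neg]
  tr_hom_1[THEN module_hom.zero] tr_hom_2[THEN module_hom.zero] tr_hom_3[THEN module_hom.zero]

lemma br_skew: "br x y = - br y x"
proof -
  have "br (x + y) (x + y) = br x y + br y x"
    by (simp only: multilinear_simps) (simp add: br_alternating)
  then show ?thesis using br_alternating[of "x + y"] by (metis eq_neg_iff_add_eq_0)
qed

lemma tr_skew: "tr x y z = - tr y x z"
proof -
  have "tr (x + y) (x + y) z = tr x y z + tr y x z"
    by (simp only: multilinear_simps) (simp add: tr_alternating)
  then show ?thesis using tr_alternating[of "x + y"] by (metis eq_neg_iff_add_eq_0)
qed

lemma jacobiator:
  "br (br x y) z + br (br y z) x + br (br z x) y = - (tr x y z + tr y z x + tr z x y)"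
  using LY1[of x y z] by (simp add: eq_neg_iff_add_eq_0 algebra_simps)

end

context nijenhuis_operator
begin

lemmas N_hom = N_linear[THEN Vector_Spaces.linear.axioms(3)]
lemmas N_simps = N_hom[THEN module_hom.add] N_hom[THEN module_hom.diff] N_hom[THEN module_hom.scale]
  N_hom[THEN module_hom.neg] N_hom[THEN module_hom.zero]

text \<open>The operations \<open>pencil_br s\<close> and \<open>pencil_tr s\<close> are those that \<open>pencil s\<close> carries to \<open>br\<close> and
  \<open>tr\<close>. They are found by expanding \<open>br\<close> and \<open>tr\<close> at arguments \<open>s x + N x\<close> in powers of \<open>s\<close> and
  dividing by \<open>s + N\<close>; the Nijenhuis identities say that the division leaves no remainder.\<close>

definition pencil :: "'k \<Rightarrow> 'g \<Rightarrow> 'g" where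
  "pencil s x = scale s x + N x"

definition pencil_br :: "'k \<Rightarrow> 'g \<Rightarrow> 'g \<Rightarrow> 'g" where
  "pencil_br s x y = scale s (br x y) + deformed_br br N x y"

definition tr_linear_part :: "'g \<Rightarrow> 'g \<Rightarrow> 'g \<Rightarrow> 'g" where
  "tr_linear_part x y z = tr (N x) y z + tr x (N y) z + tr x y (N z) - N (tr x y z)"

definition pencil_tr :: "'k \<Rightarrow> 'g \<Rightarrow> 'g \<Rightarrow> 'g \<Rightarrow> 'g" where
  "pencil_tr s x y z =
    scale s (scale s (tr x y z)) + scale s (tr_linear_part x y z) + deformed_tr tr N x y z"

lemma pencil_add: "pencil s (x + y) = pencil s x + pencil s y"
  by (simp add: pencil_def N_simps scale_right_distrib)

lemma pencil_diff: "pencil s (x - y) = pencil s x - pencil s y"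
  by (simp add: pencil_def N_simps scale_right_diff_distrib)

lemma pencil_pencil_br: "pencil s (pencil_br s x y) = br (pencil s x) (pencil s y)"
proof -
  have "pencil s (pencil_br s x y) =
    scale s (scale s (br x y)) + scale s (deformed_br br N x y + N (br x y)) + br (N x) (N y)"
    by (simp add: pencil_def pencil_br_def nijenhuis_br N_simps scale_right_distrib ac_simps)
  also have "deformed_br br N x y + N (br x y) = br (N x) y + br x (N y)"
    by (simp add: deformed_br_def)
  finally show ?thesis
    by (simp add: pencil_def multilinear_simps scale_right_distrib ac_simps)
qed

lemma pencil_pencil_tr: "pencil s (pencil_tr s x y z) = tr (pencil s x) (pencil s y) (pencil s z)"
proof -
  have "pencil s (pencil_tr s x y z) =
    scale s (scale s (scale s (tr x y z)))
    + scale s (scale s (tr_linear_part x y z + N (tr x y z)))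
    + scale s (deformed_tr tr N x y z + N (tr_linear_part x y z))
    + tr (N x) (N y) (N z)"
    by (simp add: pencil_def pencil_tr_def nijenhuis_tr N_simps scale_right_distrib ac_simps)
  also have "tr_linear_part x y z + N (tr x y z) = tr (N x) y z + tr x (N y) z + tr x y (N z)"
    by (simp add: tr_linear_part_def)
  also have "deformed_tr tr N x y z + N (tr_linear_part x y z) =
      tr (N x) (N y) z + tr x (N y) (N z) + tr (N x) y (N z)"
    by (simp add: tr_linear_part_def deformed_tr_def N_simps)
  finally show ?thesis
    by (simp add: pencil_def multilinear_simps scale_right_distrib ac_simps)
qed

lemma deformed_br_linear:
  "Vector_Spaces.linear scale scale (\<lambda>x. deformed_br br N x y)"
  "Vector_Spaces.linear scale scale (\<lambda>y. deformed_br br N x y)"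
  by (auto simp: vector_space_linear_iff vector_space_axioms deformed_br_def N_simps multilinear_simps algebra_simps)

lemma deformed_tr_linear:
  "Vector_Spaces.linear scale scale (\<lambda>x. deformed_tr tr N x y z)"
  "Vector_Spaces.linear scale scale (\<lambda>y. deformed_tr tr N x y z)"
  "Vector_Spaces.linear scale scale (\<lambda>z. deformed_tr tr N x y z)"
  by (auto simp: vector_space_linear_iff vector_space_axioms deformed_tr_def N_simps multilinear_simps algebra_simps)

lemma tr_linear_part_linear:
  "Vector_Spaces.linear scale scale (\<lambda>x. tr_linear_part x y z)"
  "Vector_Spaces.linear scale scale (\<lambda>y. tr_linear_part x y z)"
  "Vector_Spaces.linear scale scale (\<lambda>z. tr_linear_part x y z)"
  by (auto simp: vector_space_linear_iff vector_space_axioms tr_linear_part_def N_simps multilinear_simps algebra_simps)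

lemma polynomial_curve_pencil_br:
  assumes "polynomial_curve scale f" "polynomial_curve scale g"
  shows "polynomial_curve scale (\<lambda>s. pencil_br s (f s) (g s))"
  unfolding pencil_br_def
  by (intro polynomial_curve.add polynomial_curve.shift assms
      polynomial_curve_bilinear[where B = br] polynomial_curve_bilinear[where B = "deformed_br br N"]
      br_linear_left br_linear_right deformed_br_linear)

lemma polynomial_curve_pencil_tr:
  assumes "polynomial_curve scale f" "polynomial_curve scale g" "polynomial_curve scale h"
  shows "polynomial_curve scale (\<lambda>s. pencil_tr s (f s) (g s) (h s))"
  unfolding pencil_tr_def
  by (intro polynomial_curve.add polynomial_curve.shift assms
      polynomial_curve_trilinear[where B = tr] polynomial_curve_trilinear[where B = tr_linear_part]
      polynomial_curve_trilinear[where B = "deformed_tr tr N"]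
      tr_linear_1 tr_linear_2 tr_linear_3 deformed_tr_linear tr_linear_part_linear)

lemmas polynomial_curve_pencil = polynomial_curve.add polynomial_curve.const
  polynomial_curve_pencil_br polynomial_curve_pencil_tr

lemma vanishes_if_pencil_vanishes:
  assumes "polynomial_curve scale f" and "\<And>s. pencil s (f s) = 0"
  shows "f 0 = 0"
  using polynomial_curve_annihilated_by_pencil[OF N_linear assms(1)] assms(2)
  unfolding pencil_def by blast

lemma equal_if_pencil_equal:
  assumes f: "polynomial_curve scale f" and g: "polynomial_curve scale g"
    and eq: "\<And>s. pencil s (f s) = pencil s (g s)"
  shows "f 0 = g 0"
proof -
  have neg: "Vector_Spaces.linear scale scale uminus"
    by (simp add: vector_space_linear_iff vector_space_axioms)
  have "f 0 + - g 0 = 0"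
    by (rule vanishes_if_pencil_vanishes[of "\<lambda>s. f s + - g s"])
      (simp_all add: polynomial_curve.add f polynomial_curve_linear_image[OF neg g]
        pencil_diff eq del: add_uminus_conv_diff, simp add: pencil_diff eq)
  then show ?thesis by simp
qed

lemma pencil_at_0: "pencil_br 0 = deformed_br br N" "pencil_tr 0 = deformed_tr tr N"
  by (simp_all add: fun_eq_iff pencil_br_def pencil_tr_def)

text \<open>Each identity holds for the pencil at every \<open>s\<close>, since \<open>pencil s\<close> turns it into the same identity
  for \<open>br\<close> and \<open>tr\<close>; it is then read off at \<open>s = 0\<close>.\<close>

theorem lie_yamaguti_algebra_deformed:
  "lie_yamaguti_algebra scale (deformed_br br N) (deformed_tr tr N)"
proof (intro lie_yamaguti_algebra.intro lie_yamaguti_algebra_axioms.intro vector_space_axioms)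
  show "deformed_br br N x x = 0" for x
    using br_skew[of x "N x"] by (simp add: deformed_br_def br_alternating N_simps)
  show "deformed_tr tr N x x z = 0" for x z
    using tr_skew[of x "N x"]
    by (simp add: deformed_tr_def tr_alternating N_simps)
next
  fix x y z w t
  let ?b = pencil_br and ?t = pencil_tr
  let ?d = "deformed_br br N" and ?e = "deformed_tr tr N"
  show "?d (?d x y) z + ?d (?d y z) x + ?d (?d z x) y + ?e x y z + ?e y z x + ?e z x y = 0"
    using vanishes_if_pencil_vanishes[of "\<lambda>s. ?b s (?b s x y) z + ?b s (?b s y z) x
      + ?b s (?b s z x) y + ?t s x y z + ?t s y z x + ?t s z x y"]
    by (simp add: polynomial_curve_pencil pencil_add pencil_pencil_br pencil_pencil_tr LY1 pencil_at_0)
  show "?e (?d x y) z w + ?e (?d y z) x w + ?e (?d z x) y w = 0"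
    using vanishes_if_pencil_vanishes[of "\<lambda>s. ?t s (?b s x y) z w
      + ?t s (?b s y z) x w + ?t s (?b s z x) y w"]
    by (simp add: polynomial_curve_pencil pencil_add pencil_pencil_br pencil_pencil_tr LY2 pencil_at_0)
  show "?e x y (?d z w) = ?d (?e x y z) w + ?d z (?e x y w)"
    using equal_if_pencil_equal[of "\<lambda>s. ?t s x y (?b s z w)"
      "\<lambda>s. ?b s (?t s x y z) w + ?b s z (?t s x y w)"]
    by (simp add: polynomial_curve_pencil pencil_add pencil_pencil_br pencil_pencil_tr LY3 pencil_at_0)
  show "?e x y (?e z w t) = ?e (?e x y z) w t + ?e z (?e x y w) t + ?e z w (?e x y t)"
    using equal_if_pencil_equal[of "\<lambda>s. ?t s x y (?t s z w t)"
      "\<lambda>s. ?t s (?t s x y z) w t + ?t s z (?t s x y w) t + ?t s z w (?t s x y t)"]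
    by (simp add: polynomial_curve_pencil pencil_add pencil_pencil_br pencil_pencil_tr
        LY4[of "pencil s x" "pencil s y" for s] pencil_at_0)
qed (rule deformed_br_linear deformed_tr_linear)+

end

section \<open>Subalgebras\<close>

lemma linear_if_injective_comp:
  assumes emb: "Vector_Spaces.linear s1 s2 \<iota>" "inj \<iota>"
    and comp: "Vector_Spaces.linear s1 s2 (\<lambda>x. \<iota> (f x))"
  shows "Vector_Spaces.linear s1 s1 f"
  using assms unfolding vector_space_linear_iff inj_def by metis

lemma lie_yamaguti_algebra_pullback:
  fixes scale :: "'k::field_char_0 \<Rightarrow> 'g::ab_group_add \<Rightarrow> 'g"
    and scale' :: "'k \<Rightarrow> 'v::ab_group_add \<Rightarrow> 'v"
  assumes "lie_yamaguti_algebra scale br tr"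
    and emb: "Vector_Spaces.linear scale' scale \<iota>" "inj \<iota>"
    and br': "\<And>u v. \<iota> (br' u v) = br (\<iota> u) (\<iota> v)"
    and tr': "\<And>u v w. \<iota> (tr' u v w) = tr (\<iota> u) (\<iota> v) (\<iota> w)"
  shows "lie_yamaguti_algebra scale' br' tr'"
proof -
  interpret lie_yamaguti_algebra scale br tr by fact
  interpret dom: vector_space scale' using emb(1) by (simp add: vector_space_linear_iff)
  note emb_hom = emb(1)[THEN Vector_Spaces.linear.axioms(3)]
  note emb_simps = emb_hom[THEN module_hom.add] emb_hom[THEN module_hom.diff]
    emb_hom[THEN module_hom.scale] emb_hom[THEN module_hom.zero]
  note lin = linear_if_injective_comp[OF emb]
  note simps = br' tr' emb_simps multilinear_simps
  show ?thesis
  proof (intro lie_yamaguti_algebra.intro lie_yamaguti_algebra_axioms.intro dom.vector_space_axioms)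
    show "Vector_Spaces.linear scale' scale' (\<lambda>x. br' x y)"
      "Vector_Spaces.linear scale' scale' (br' y)" for y
      by (rule lin, simp add: vector_space_linear_iff vector_space_axioms dom.vector_space_axioms simps)+
    show "Vector_Spaces.linear scale' scale' (\<lambda>x. tr' x y z)"
      "Vector_Spaces.linear scale' scale' (\<lambda>x. tr' y x z)"
      "Vector_Spaces.linear scale' scale' (tr' y z)" for y z
      by (rule lin, simp add: vector_space_linear_iff vector_space_axioms dom.vector_space_axioms simps)+
  next
    fix x y z w t
    note eq = injD[OF emb(2)]
    show "br' x x = 0"
      by (rule eq) (simp only: simps br_alternating)
    show "tr' x x z = 0"
      by (rule eq) (simp only: simps tr_alternating)
    show "br' (br' x y) z + br' (br' y z) x + br' (br' z x) y
        + tr' x y z + tr' y z x + tr' z x y = 0"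
      by (rule eq) (simp only: simps LY1)
    show "tr' (br' x y) z w + tr' (br' y z) x w + tr' (br' z x) y w = 0"
      by (rule eq) (simp only: simps LY2)
    show "tr' x y (br' z w) = br' (tr' x y z) w + br' z (tr' x y w)"
      by (rule eq) (simp only: simps LY3)
    show "tr' x y (tr' z w t) = tr' (tr' x y z) w t + tr' z (tr' x y w) t + tr' z w (tr' x y t)"
      by (rule eq) (simp only: simps, rule LY4)
  qed
qed

lemma nijenhuis_operator_pullback:
  fixes scale :: "'k::field_char_0 \<Rightarrow> 'g::ab_group_add \<Rightarrow> 'g"
    and scale' :: "'k \<Rightarrow> 'v::ab_group_add \<Rightarrow> 'v"
  assumes "nijenhuis_operator scale br tr N"
    and emb: "Vector_Spaces.linear scale' scale \<iota>" "inj \<iota>"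
    and br': "\<And>u v. \<iota> (br' u v) = br (\<iota> u) (\<iota> v)"
    and tr': "\<And>u v w. \<iota> (tr' u v w) = tr (\<iota> u) (\<iota> v) (\<iota> w)"
    and S: "\<And>u. \<iota> (S u) = N (\<iota> u)"
  shows "nijenhuis_operator scale' br' tr' S"
proof -
  interpret nijenhuis_operator scale br tr N by fact
  interpret dom: lie_yamaguti_algebra scale' br' tr'
    by (rule lie_yamaguti_algebra_pullback[where \<iota> = \<iota> and br = br and tr = tr,
          OF lie_yamaguti_algebra_axioms emb br' tr'])
  note emb_hom = emb(1)[THEN Vector_Spaces.linear.axioms(3)]
  note emb_simps = emb_hom[THEN module_hom.add] emb_hom[THEN module_hom.diff]
    emb_hom[THEN module_hom.scale] emb_hom[THEN module_hom.zero]
  show ?thesis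
  proof (intro nijenhuis_operator.intro nijenhuis_operator_axioms.intro dom.lie_yamaguti_algebra_axioms)
    show "Vector_Spaces.linear scale' scale' S"
      by (rule linear_if_injective_comp[OF emb])
        (simp add: vector_space_linear_iff vector_space_axioms dom.vector_space_axioms S emb_simps N_simps)
    show "br' (S u) (S v) = S (deformed_br br' S u v)" for u v
      by (rule injD[OF emb(2)])
        (simp only: br' S nijenhuis_br deformed_br_def emb_simps)
    show "tr' (S u) (S v) (S w) = S (deformed_tr tr' S u v w)" for u v w
      by (rule injD[OF emb(2)])
        (simp only: tr' S nijenhuis_tr deformed_tr_def emb_simps)
  qed
qed

section \<open>Semidirect products\<close>

definition semidirect_br ::
  "('g \<Rightarrow> 'g \<Rightarrow> 'g) \<Rightarrow> ('g \<Rightarrow> 'v::ab_group_add \<Rightarrow> 'v) \<Rightarrow> 'g \<times> 'v \<Rightarrow> 'g \<times> 'v \<Rightarrow> 'g \<times> 'v"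
where
  "semidirect_br br \<rho> p q =
    (br (fst p) (fst q), \<rho> (fst p) (snd q) - \<rho> (fst q) (snd p))"

definition semidirect_tr ::
  "('g \<Rightarrow> 'g \<Rightarrow> 'g \<Rightarrow> 'g) \<Rightarrow> ('g \<Rightarrow> 'g \<Rightarrow> 'v::ab_group_add \<Rightarrow> 'v) \<Rightarrow> ('g \<Rightarrow> 'g \<Rightarrow> 'v \<Rightarrow> 'v)
    \<Rightarrow> 'g \<times> 'v \<Rightarrow> 'g \<times> 'v \<Rightarrow> 'g \<times> 'v \<Rightarrow> 'g \<times> 'v"
where
  "semidirect_tr tr D \<mu> p q r =
    (tr (fst p) (fst q) (fst r),
     D (fst p) (fst q) (snd r) + \<mu> (fst q) (fst r) (snd p) - \<mu> (fst p) (fst r) (snd q))"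

context lieyrep_pair
begin

abbreviation D where "D \<equiv> rep_D br \<rho> \<mu>"

abbreviation scaleGV where "scaleGV \<equiv> module_prod.scale scaleG scaleV"

lemmas rho_hom_endo = rho_endo[THEN Vector_Spaces.linear.axioms(3)]
lemmas rho_hom = rho_linear[THEN Vector_Spaces.linear.axioms(3)]
lemmas mu_hom_endo = mu_endo[THEN Vector_Spaces.linear.axioms(3)]
lemmas mu_hom_left = mu_linear_left[THEN Vector_Spaces.linear.axioms(3)]
lemmas mu_hom_right = mu_linear_right[THEN Vector_Spaces.linear.axioms(3)]

lemmas rep_simps =
  rho_hom_endo[THEN module_hom.add] rho_hom[THEN module_hom.add]
  rho_hom_endo[THEN module_hom.diff] rho_hom[THEN module_hom.diff]
  rho_hom_endo[THEN module_hom.neg] rho_hom[THEN module_hom.neg]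
  rho_hom_endo[THEN module_hom.scale] rho_hom[THEN module_hom.scale]
  rho_hom_endo[THEN module_hom.zero] rho_hom[THEN module_hom.zero]
  mu_hom_endo[THEN module_hom.add] mu_hom_left[THEN module_hom.add] mu_hom_right[THEN module_hom.add]
  mu_hom_endo[THEN module_hom.diff] mu_hom_left[THEN module_hom.diff] mu_hom_right[THEN module_hom.diff]
  mu_hom_endo[THEN module_hom.neg] mu_hom_left[THEN module_hom.neg] mu_hom_right[THEN module_hom.neg]
  mu_hom_endo[THEN module_hom.scale] mu_hom_left[THEN module_hom.scale] mu_hom_right[THEN module_hom.scale]
  mu_hom_endo[THEN module_hom.zero] mu_hom_left[THEN module_hom.zero] mu_hom_right[THEN module_hom.zero]

lemma D_simps:
  "D x y (v + v') = D x y v + D x y v'"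
  "D x y (v - v') = D x y v - D x y v'"
  "D x y (scaleV c v) = scaleV c (D x y v)"
  "D (x + x') y v = D x y v + D x' y v"
  "D x (y + y') v = D x y v + D x y' v"
  "D (scaleG c x) y v = scaleV c (D x y v)"
  "D x (scaleG c y) v = scaleV c (D x y v)"
  by (simp_all add: rep_D_def rep_simps alg.multilinear_simps rep.scale_right_diff_distrib
      rep.scale_right_distrib)

lemma D_alternating: "D x x v = 0"
  by (simp add: rep_D_def alg.br_alternating rep_simps)

text \<open>The two identities for \<open>D\<close> that the axioms of a representation leave implicit; they are what
  the fundamental identities of the semidirect product require of its component \<open>D x y w\<close>.
  In the first, the terms \<open>\<rho> (br (br x y) z)\<close> are traded by the Jacobi-type identity for \<open>\<rho> (tr x y z)\<close>, hence for
  commutators of \<open>D\<close> and \<open>\<rho>\<close>; the second says that \<open>D x y\<close>, being a derivation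
  of \<open>\<rho>\<close>, \<open>\<mu>\<close> and \<open>br\<close>, is one of \<open>D\<close>.\<close>

lemma D_cyclic: "D (br x y) z v + D (br y z) x v + D (br z x) y v = 0"
proof -
  have jac: "\<rho> (br (br x y) z) v + \<rho> (br (br y z) x) v + \<rho> (br (br z x) y) v
    = - (\<rho> (tr x y z) v + \<rho> (tr y z x) v + \<rho> (tr z x y) v)"
    using arg_cong[OF alg.jacobiator[of x y z], of "\<lambda>a. \<rho> a v"] by (simp only: rep_simps)
  have mu: "\<mu> (br a b) c v = \<mu> a c (\<rho> b v) - \<mu> b c (\<rho> a v)"
    "\<mu> a (br b c) v = \<rho> b (\<mu> a c v) - \<rho> c (\<mu> a b v)" for a b c
    using rep1[of a b c v] rep2[of a b c v] by (simp_all add: algebra_simps)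
  have "D (br x y) z v + D (br y z) x v + D (br z x) y v
    = (\<mu> z (br x y) v - \<mu> (br x y) z v + (\<rho> (br x y) (\<rho> z v) - \<rho> z (\<rho> (br x y) v)))
    + (\<mu> x (br y z) v - \<mu> (br y z) x v + (\<rho> (br y z) (\<rho> x v) - \<rho> x (\<rho> (br y z) v)))
    + (\<mu> y (br z x) v - \<mu> (br z x) y v + (\<rho> (br z x) (\<rho> y v) - \<rho> y (\<rho> (br z x) v)))
    - (\<rho> (br (br x y) z) v + \<rho> (br (br y z) x) v + \<rho> (br (br z x) y) v)"
    by (simp add: rep_D_def)
  also have "\<dots> = 0"
    unfolding jac rep3 mu by (simp add: rep_D_def rep_simps)
  finally show ?thesis .
qed

lemma D_D: "D x y (D z w v) = D (tr x y z) w v + D z (tr x y w) v + D z w (D x y v)"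
proof -
  have mu: "D x y (\<mu> a b u) = \<mu> (tr x y a) b u + \<mu> a (tr x y b) u + \<mu> a b (D x y u)" for a b u
    using rep5[of x y a b u] by (simp add: algebra_simps)
  have rho: "D x y (\<rho> a u) = \<rho> (tr x y a) u + \<rho> a (D x y u)" for a u
    using rep3[of x y a u] by (simp add: algebra_simps)
  have "D x y (D z w v) = D x y (\<mu> w z v) - D x y (\<mu> z w v)
      + (D x y (\<rho> z (\<rho> w v)) - D x y (\<rho> w (\<rho> z v))) - D x y (\<rho> (br z w) v)"
    by (simp add: rep_D_def[of _ _ _ z w] D_simps)
  also have "\<dots> = D (tr x y z) w v + D z (tr x y w) v + D z w (D x y v)"
    unfolding mu rho alg.LY3 rep_simps
    by (simp add: rep_D_def[of _ _ _ "tr x y z"] rep_D_def[of _ _ _ z] algebra_simps)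
  finally show ?thesis .
qed

lemma vector_space_prod: "vector_space_prod scaleG scaleV"
  by (simp add: vector_space_prod_def vector_space_pair_def alg.vector_space_axioms
      rep.vector_space_axioms)

lemma scaleGV_def: "scaleGV c p = (scaleG c (fst p), scaleV c (snd p))"
proof -
  interpret vector_space_prod scaleG scaleV by (rule vector_space_prod)
  show ?thesis by (rule scale_def)
qed

lemma vector_space_scaleGV: "vector_space scaleGV"
proof -
  interpret vector_space_prod scaleG scaleV by (rule vector_space_prod)
  show ?thesis by (rule p.vector_space_axioms)
qed

text \<open>In the first component the identities are those of \<open>\<gg>\<close>. In the second they are linear in each
  \<open>V\<close>-argument, and comparing the coefficients of each such argument leaves an
  axiom of a representation, the definition of \<open>D\<close>, or one of the two identities for \<open>D\<close> above.\<close>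

theorem lie_yamaguti_algebra_semidirect:
  "lie_yamaguti_algebra scaleGV (semidirect_br br \<rho>) (semidirect_tr tr D \<mu>)"
proof (intro lie_yamaguti_algebra.intro lie_yamaguti_algebra_axioms.intro vector_space_scaleGV)
  fix X Y Z W Q :: "'g \<times> 'v"
  let ?b = "semidirect_br br \<rho>" and ?t = "semidirect_tr tr D \<mu>"
  obtain x a y b z c w d q e
    where [simp]: "X = (x, a)" "Y = (y, b)" "Z = (z, c)" "W = (w, d)" "Q = (q, e)"
    by (metis surj_pair)
  note defs = semidirect_br_def semidirect_tr_def scaleGV_def
  note simps = defs vector_space_linear_iff vector_space_scaleGV rep_simps D_simps
    alg.multilinear_simps rep.scale_right_diff_distrib rep.scale_right_distrib
  show "Vector_Spaces.linear scaleGV scaleGV (\<lambda>X. ?b X Y)"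
    by (simp add: simps)
  show "Vector_Spaces.linear scaleGV scaleGV (?b X)"
    by (simp add: simps)
  show "?b X X = 0" by (simp add: defs alg.br_alternating zero_prod_def)
  show "Vector_Spaces.linear scaleGV scaleGV (\<lambda>X. ?t X Y Z)"
    by (simp add: simps)
  show "Vector_Spaces.linear scaleGV scaleGV (\<lambda>Y. ?t X Y Z)"
    by (simp add: simps)
  show "Vector_Spaces.linear scaleGV scaleGV (?t X Y)"
    by (simp add: simps)
  show "?t X X Z = 0" by (simp add: defs alg.tr_alternating D_alternating zero_prod_def)
  show "?b (?b X Y) Z + ?b (?b Y Z) X + ?b (?b Z X) Y + ?t X Y Z + ?t Y Z X + ?t Z X Y = 0"
    using alg.LY1[of x y z] by (simp add: defs zero_prod_def rep_simps rep_D_def)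
  show "?t (?b X Y) Z W + ?t (?b Y Z) X W + ?t (?b Z X) Y W = 0"
  proof -
    have mu: "\<mu> (br x y) w v = \<mu> x w (\<rho> y v) - \<mu> y w (\<rho> x v)" for x y w v
      using rep1[of x y w v] by (simp add: algebra_simps)
    show ?thesis
      using alg.LY2[of x y z w] D_cyclic[of x y z d]
      by (simp add: defs zero_prod_def rep_simps mu algebra_simps)
  qed
  show "?t X Y (?b Z W) = ?b (?t X Y Z) W + ?b Z (?t X Y W)"
  proof -
    have mu: "\<mu> x (br z w) v = \<rho> z (\<mu> x w v) - \<rho> w (\<mu> x z v)" for x v
      using rep2[of x z w v] by (simp add: algebra_simps)
    show ?thesis
      by (simp add: defs alg.LY3 rep_simps D_simps mu rep3 algebra_simps)
  qed
  show "?t X Y (?t Z W Q) = ?t (?t X Y Z) W Q + ?t Z (?t X Y W) Q + ?t Z W (?t X Y Q)"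
  proof -
    have D_mu: "D x y (\<mu> u q v) = \<mu> (tr x y u) q v + \<mu> u (tr x y q) v + \<mu> u q (D x y v)" for u v
      using rep5[of x y u q v] by (simp add: algebra_simps)
    have mu_tr: "\<mu> u (tr z w q) v = \<mu> w q (\<mu> u z v) - \<mu> z q (\<mu> u w v) + D z w (\<mu> u q v)" for u v
      using rep4[of w q u z v] by (simp add: algebra_simps)
    \<comment> \<open>\<open>D_D\<close> matches the coefficients of \<open>e\<close>, \<open>D_mu\<close> those of \<open>c\<close> and \<open>d\<close>, and \<open>mu_tr\<close> those of
      \<open>a\<close> and \<open>b\<close>.\<close>
    have "D x y (D z w e + \<mu> w q c - \<mu> z q d) + \<mu> y (tr z w q) a - \<mu> x (tr z w q) b =
        D (tr x y z) w e + \<mu> w q (D x y c + \<mu> y z a - \<mu> x z b) - \<mu> (tr x y z) q d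
      + (D z (tr x y w) e + \<mu> (tr x y w) q c - \<mu> z q (D x y d + \<mu> y w a - \<mu> x w b))
      + (D z w (D x y e + \<mu> y q a - \<mu> x q b) + \<mu> w (tr x y q) c - \<mu> z (tr x y q) d)"
      unfolding D_simps rep_simps D_D[of x y z w] D_mu mu_tr by (simp add: algebra_simps)
    then show ?thesis by (simp add: defs alg.LY4[of x y])
  qed
qed

end

section \<open>The lifted Nijenhuis operator\<close>

context nijenhuis_structure
begin

lemmas S_hom = S_linear[THEN Vector_Spaces.linear.axioms(3)]
lemmas S_simps = S_hom[THEN module_hom.add] S_hom[THEN module_hom.diff] S_hom[THEN module_hom.scale]

lemma rho_N_S: "\<rho> (N x) (S v) = S (\<rho> (N x) v) + S (\<rho> x (S v)) - S (S (\<rho> x v))"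
  by (simp add: nijenhuis_rho hat1_def S_simps)

text \<open>The operation taking \<open>F\<close> to \<open>hat2 F N S\<close> is the one that a quadratic expression in \<open>\<rho>\<close> undergoes
  when every \<open>\<rho>\<close> is hatted: the surplus mixed terms, such as \<open>\<rho> x (S (S (\<rho> y v)))\<close>, cancel by the
  Nijenhuis relation for \<open>\<rho>\<close>. The next lemma says the same of \<open>\<rho> (br x y)\<close>, where also the bracket
  is deformed.\<close>

lemma hat1_hat1: "hat1 \<rho> N S x (hat1 \<rho> N S y v) = hat2 (\<lambda>x y v. \<rho> x (\<rho> y v)) N S x y v"
  by (simp add: hat1_def hat2_def S_simps rep_simps rho_N_S algebra_simps)

lemma hat1_deformed_br:
  "hat1 \<rho> N S (deformed_br br N x y) v = hat2 (\<lambda>x y. \<rho> (br x y)) N S x y v"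
  unfolding hat1_def nij.nijenhuis_br[symmetric]
  by (simp add: deformed_br_def hat2_def S_simps rep_simps rho_N_S algebra_simps)

text \<open>Only \<open>\<rho>\<close> and \<open>\<mu>\<close> are required to satisfy Nijenhuis relations; \<open>D\<close> inherits one because it is
  assembled from \<open>\<mu>\<close>, products \<open>\<rho> x \<circ> \<rho> y\<close> and \<open>\<rho> (br x y)\<close>, and \<open>hat2\<close> is linear in \<open>F\<close>.\<close>

lemma nijenhuis_D: "D (N x) (N y) (S v) = S (hat2 D N S x y v)"
proof -
  have rho: "\<rho> (N x) (\<rho> (N y) (S v)) = S (hat2 (\<lambda>x y v. \<rho> x (\<rho> y v)) N S x y v)" for x y
    by (simp add: nijenhuis_rho hat1_hat1)
  have br: "\<rho> (br (N x) (N y)) (S v) = S (hat2 (\<lambda>x y. \<rho> (br x y)) N S x y v)"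
    by (simp add: nij.nijenhuis_br nijenhuis_rho hat1_deformed_br)
  show ?thesis
    unfolding rep_D_def[of _ _ _ "N x" "N y"] rho br nijenhuis_mu
    by (simp add: hat2_def rep_D_def S_simps algebra_simps)
qed

lemma deformed_semidirect_br:
  "deformed_br (semidirect_br br \<rho>) (map_prod N S) p q =
    semidirect_br (deformed_br br N) (hat1 \<rho> N S) p q"
  by (simp add: deformed_br_def semidirect_br_def hat1_def prod_eq_iff S_simps)

lemma deformed_semidirect_tr:
  "deformed_tr (semidirect_tr tr D \<mu>) (map_prod N S) p q r =
    semidirect_tr (deformed_tr tr N) (hat2 D N S) (hat2 \<mu> N S) p q r"
  by (simp add: deformed_tr_def semidirect_tr_def hat2_def prod_eq_iff S_simps algebra_simps)

theorem nijenhuis_operator_semidirect: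
  "nijenhuis_operator scaleGV (semidirect_br br \<rho>) (semidirect_tr tr D \<mu>) (map_prod N S)"
proof (intro nijenhuis_operator.intro nijenhuis_operator_axioms.intro lie_yamaguti_algebra_semidirect)
  show "Vector_Spaces.linear scaleGV scaleGV (map_prod N S)"
    by (simp add: vector_space_linear_iff vector_space_scaleGV scaleGV_def nij.N_simps S_simps
        prod_eq_iff)
  fix p q r :: "'g \<times> 'v"
  show "semidirect_br br \<rho> (map_prod N S p) (map_prod N S q) =
      map_prod N S (deformed_br (semidirect_br br \<rho>) (map_prod N S) p q)"
    unfolding deformed_semidirect_br
    by (simp add: semidirect_br_def nij.nijenhuis_br nijenhuis_rho S_simps)
  show "semidirect_tr tr D \<mu> (map_prod N S p) (map_prod N S q) (map_prod N S r) =
      map_prod N S (deformed_tr (semidirect_tr tr D \<mu>) (map_prod N S) p q r)"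
    unfolding deformed_semidirect_tr
    by (simp add: semidirect_tr_def nij.nijenhuis_tr nijenhuis_D nijenhuis_mu S_simps)
qed

end

section \<open>Relative Rota-Baxter operators and their graphs\<close>

context relative_rota_baxter_operator
begin

definition graph :: "'v \<Rightarrow> 'g \<times> 'v" where
  "graph u = (T u, u)"

lemma graph_linear: "Vector_Spaces.linear scaleV scaleGV graph"
  using T_linear
  by (auto simp: vector_space_linear_iff vector_space_scaleGV scaleGV_def graph_def prod_eq_iff)

lemma inj_graph: "inj graph"
  by (simp add: inj_def graph_def)

lemma graph_br: "graph (induced_br \<rho> T u v) = semidirect_br br \<rho> (graph u) (graph v)"
  by (simp add: graph_def semidirect_br_def rota_baxter_br) (simp add: induced_br_def)

lemma graph_tr: "graph (induced_tr D \<mu> T u v w) = semidirect_tr tr D \<mu> (graph u) (graph v) (graph w)"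
  by (simp add: graph_def semidirect_tr_def rota_baxter_tr) (simp add: induced_tr_def)

end

context relative_rota_baxter_nijenhuis_structure
begin

lemma graph_S: "rota_baxter.graph (S u) = map_prod N S (rota_baxter.graph u)"
  using NT_eq_TS by (simp add: rota_baxter.graph_def fun_eq_iff)

lemma nijenhuis_operator_subadjacent:
  "nijenhuis_operator scaleV (induced_br \<rho> T) (induced_tr D \<mu> T) S"
  by (rule nijenhuis_operator_pullback[where \<iota> = rota_baxter.graph
        and br = "semidirect_br br \<rho>" and tr = "semidirect_tr tr D \<mu>",
        OF nijenhuis_operator_semidirect rota_baxter.graph_linear rota_baxter.inj_graph
          rota_baxter.graph_br rota_baxter.graph_tr graph_S])

lemma deformed_br_eq_hat:
  "deformed_br (induced_br \<rho> T) S = induced_br (hat1 \<rho> N S) T"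
proof (intro ext)
  fix u v
  have T: "N (T u) = T (S u)" for u using NT_eq_TS by (simp add: fun_eq_iff)
  show "deformed_br (induced_br \<rho> T) S u v = induced_br (hat1 \<rho> N S) T u v"
    by (simp add: deformed_br_def induced_br_def hat1_def T S_simps)
qed

lemma deformed_tr_eq_hat:
  "deformed_tr (induced_tr D \<mu> T) S = induced_tr (hat2 D N S) (hat2 \<mu> N S) T"
proof (intro ext)
  fix u v w
  have T: "N (T u) = T (S u)" for u using NT_eq_TS by (simp add: fun_eq_iff)
  show "deformed_tr (induced_tr D \<mu> T) S u v w = induced_tr (hat2 D N S) (hat2 \<mu> N S) T u v w"
    by (simp add: deformed_tr_def induced_tr_def hat2_def T S_simps algebra_simps)
qed

end

theorem theorem4p5:
  fixes scaleG :: "'k::field_char_0 \<Rightarrow> 'g::ab_group_add \<Rightarrow> 'g"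
    and scaleV :: "'k \<Rightarrow> 'v::ab_group_add \<Rightarrow> 'v"
    and BG :: "'g set" and BV :: "'v set"
    and br :: "'g \<Rightarrow> 'g \<Rightarrow> 'g" and tr :: "'g \<Rightarrow> 'g \<Rightarrow> 'g \<Rightarrow> 'g"
    and \<rho> :: "'g \<Rightarrow> 'v \<Rightarrow> 'v" and \<mu> :: "'g \<Rightarrow> 'g \<Rightarrow> 'v \<Rightarrow> 'v"
    and T :: "'v \<Rightarrow> 'g" and S :: "'v \<Rightarrow> 'v" and N :: "'g \<Rightarrow> 'g"
  assumes "finite_dimensional_vector_space scaleG BG"
    and "finite_dimensional_vector_space scaleV BV"
    and "relative_rota_baxter_nijenhuis_structure scaleG br tr scaleV \<rho> \<mu> T S N"
  shows "nijenhuis_operator scaleV (induced_br \<rho> T) (induced_tr (rep_D br \<rho> \<mu>) \<mu> T) S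
    \<and> lie_yamaguti_algebra scaleV
      (deformed_br (induced_br \<rho> T) S)
      (deformed_tr (induced_tr (rep_D br \<rho> \<mu>) \<mu> T) S)
    \<and> lie_yamaguti_algebra scaleV
      (induced_br (hat1 \<rho> N S) T)
      (induced_tr (hat2 (rep_D br \<rho> \<mu>) N S) (hat2 \<mu> N S) T)"
proof -
  interpret relative_rota_baxter_nijenhuis_structure scaleG br tr scaleV \<rho> \<mu> T S N by fact
  note S_nijenhuis = nijenhuis_operator_subadjacent
  note deformed = nijenhuis_operator.lie_yamaguti_algebra_deformed[OF S_nijenhuis]
  show ?thesis
    using S_nijenhuis deformed deformed[unfolded deformed_br_eq_hat deformed_tr_eq_hat] by blast
qed

end
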